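(* Let $m\ge 1$ be an integer and let $A=\begin{bmatrix}A_{11}&A_{12}\\ A_{21}&A_{22}\end{bmatrix}\in\mathbb{R}^{2m\times 2m}$ be partitioned into $m\times m$ blocks. Then a matrix $$R^\star=\begin{bmatrix}U_{\mathrm r}^\star&-U_{\mathrm i}^\star\\ U_{\mathrm i}^\star&U_{\mathrm r}^\star\end{bmatrix}$$ with $U_{\mathrm r}^\star,U_{\mathrm i}^\star\in\mathbb{R}^{m\times m}$ is a nearest ortho-symplectic matrix to $A$, i.e. $$R^\star\in\operatorname*{argmin}_{R\in\mathrm{OSp}(2m)}\|A-R\|_{\mathrm F},$$ if and only if $U_{\mathrm r}^\star+iU_{\mathrm i}^\star=UV^*$ is a polar factor of $$\left(\frac{A_{11}+A_{22}}{2}\right)+i\left(\frac{A_{21}-A_{12}}{2}\right)=U\Sigma V^*,$$ where $U\Sigma V^*$ is a singular value decomposition. Moreover, $$\min_{R\in\mathrm{OSp}(2m)}\|A-R\|_{\mathrm F}^2=2\|\Sigma-I_m\|_{\mathrm F}^2+\frac14\|AJ-JA\|_{\mathrm F}^2 .$$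
   Context: $J:=J_2\otimes I_m=\begin{bmatrix}0&-I_m\\ I_m&0\end{bmatrix}\in\mathbb{R}^{2m\times 2m}$, where $J_2=\begin{bmatrix}0&-1\\ 1&0\end{bmatrix}$. The set of ortho-symplectic matrices is the set of orthogonal $2m\times 2m$ real matrices commuting with $J$, equivalently $$\mathrm{OSp}(2m)=\left\{\begin{bmatrix}U_{\mathrm r}&-U_{\mathrm i}\\ U_{\mathrm i}&U_{\mathrm r}\end{bmatrix}\in\mathrm{O}(2m)\ :\ U_{\mathrm r},U_{\mathrm i}\in\mathbb{R}^{m\times m}\right\},$$ where $\mathrm{O}(2m)$ is the orthogonal group. In a singular value decomposition $B=U\Sigma V^*$ of $B\in\mathbb{C}^{m\times m}$, $U,V$ are $m\times m$ unitary and $\Sigma$ is diagonal with nonnegative real diagonal entries. A polar factor of $B$ is any matrix of the form $UV^*$ arising from some singular value decomposition $B=U\Sigma V^*$ (it is non-unique when $B$ is singular). $\|\cdot\|_{\mathrm F}$ is the Frobenius norm. *)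

theory Defs
  imports "HOL-Analysis.Analysis"
begin

text \<open>The size $m \ge 1$ is the cardinality of a finite index type \<^typ>\<open>'m\<close>;
  the $2m$ row and column indices are \<^typ>\<open>'m + 'm\<close>, where \<^const>\<open>Inl\<close> addresses the first and
  \<^const>\<open>Inr\<close> the second block row or column.\<close>

definition block_matrix ::
  "'a^'m^'m \<Rightarrow> 'a^'m^'m \<Rightarrow> 'a^'m^'m \<Rightarrow> 'a^'m^'m \<Rightarrow> 'a^('m::finite + 'm)^('m + 'm)" where
  "block_matrix M11 M12 M21 M22 =
     (\<chi> i j. case i of
        Inl k \<Rightarrow> (case j of Inl l \<Rightarrow> M11 $ k $ l | Inr l \<Rightarrow> M12 $ k $ l)
      | Inr k \<Rightarrow> (case j of Inl l \<Rightarrow> M21 $ k $ l | Inr l \<Rightarrow> M22 $ k $ l))"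

definition symplectic_J :: "real^('m::finite + 'm)^('m + 'm)" where
  "symplectic_J = block_matrix 0 (- mat 1) (mat 1) 0"

definition OSp :: "(real^('m::finite + 'm)^('m + 'm)) set" where
  "OSp = {R. orthogonal_matrix R \<and> R ** symplectic_J = symplectic_J ** R}"

definition complex_matrix :: "real^'m^'m \<Rightarrow> real^'m^'m \<Rightarrow> complex^'m^'m" where
  "complex_matrix X Y = (\<chi> i j. complex_of_real (X $ i $ j) + \<i> * complex_of_real (Y $ i $ j))"

definition conj_transpose :: "complex^'n^'m \<Rightarrow> complex^'m^'n" where
  "conj_transpose M = (\<chi> i j. cnj (M $ j $ i))"

definition unitary_matrix :: "complex^'m^'m \<Rightarrow> bool" where
  "unitary_matrix U \<longleftrightarrow> conj_transpose U ** U = mat 1 \<and> U ** conj_transpose U = mat 1"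

text \<open>The singular values need not be sorted.\<close>

definition is_svd ::
  "complex^'m^'m \<Rightarrow> complex^'m^'m \<Rightarrow> complex^'m^'m \<Rightarrow> complex^'m^'m \<Rightarrow> bool" where
  "is_svd B U S V \<longleftrightarrow>
     unitary_matrix U \<and> unitary_matrix V \<and>
     (\<forall>i j. i \<noteq> j \<longrightarrow> S $ i $ j = 0) \<and> (\<forall>i. S $ i $ i \<in> \<real>\<^sub>\<ge>\<^sub>0) \<and>
     B = U ** S ** conj_transpose V"

definition is_polar_factor :: "complex^'m^'m \<Rightarrow> complex^'m^'m \<Rightarrow> bool" where
  "is_polar_factor B P \<longleftrightarrow> (\<exists>U S V. is_svd B U S V \<and> P = U ** conj_transpose V)"

text \<open>The library norm on matrices is the Frobenius norm.\<close>

lemma norm_matrix_Frobenius: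
  fixes M :: "'a::real_normed_vector^'n^'m"
  shows "norm M = sqrt (\<Sum>i\<in>UNIV. \<Sum>j\<in>UNIV. (norm (M $ i $ j))\<^sup>2)"
  by (simp add: norm_vec_def L2_set_def sum_nonneg)

definition is_nearest_OSp ::
  "real^('m::finite + 'm)^('m + 'm) \<Rightarrow> real^('m::finite + 'm)^('m + 'm) \<Rightarrow> bool" where
  "is_nearest_OSp A R \<longleftrightarrow> is_arg_min (\<lambda>R. norm (A - R)) (\<lambda>R. R \<in> OSp) R"

lemma sum_UNIV_Plus:
  fixes f :: "'m::finite + 'm \<Rightarrow> 'b::comm_monoid_add"
  shows "sum f UNIV = (\<Sum>k\<in>UNIV. f (Inl k)) + (\<Sum>k\<in>UNIV. f (Inr k))"
  by (simp add: UNIV_Plus_UNIV[symmetric] sum.Plus comp_def del: UNIV_Plus_UNIV)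

lemma block_matrix_surj:
  "\<exists>M11 M12 M21 M22. M = block_matrix M11 M12 M21 M22"
  by (rule exI[of _ "\<chi> k l. M $ Inl k $ Inl l"], rule exI[of _ "\<chi> k l. M $ Inl k $ Inr l"],
      rule exI[of _ "\<chi> k l. M $ Inr k $ Inl l"], rule exI[of _ "\<chi> k l. M $ Inr k $ Inr l"])
    (auto simp: block_matrix_def vec_eq_iff split: sum.split)

lemma block_matrix_eq_iff:
  "block_matrix a b c d = block_matrix a' b' c' d' \<longleftrightarrow> a = a' \<and> b = b' \<and> c = c' \<and> d = d'"
proof
  assume h: "block_matrix a b c d = block_matrix a' b' c' d'"
  have "block_matrix a b c d $ i $ j = block_matrix a' b' c' d' $ i $ j" for i j
    using h by simp
  from this[of "Inl _" "Inl _"] this[of "Inl _" "Inr _"]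
    this[of "Inr _" "Inl _"] this[of "Inr _" "Inr _"]
  show "a = a' \<and> b = b' \<and> c = c' \<and> d = d'"
    by (simp add: block_matrix_def vec_eq_iff)
qed simp

lemma block_matrix_mult:
  fixes a :: "'a::semiring_1^'m^'m"
  shows "block_matrix a b c d ** block_matrix a' b' c' d' =
    block_matrix (a ** a' + b ** c') (a ** b' + b ** d') (c ** a' + d ** c') (c ** b' + d ** d')"
  by (auto simp: block_matrix_def matrix_matrix_mult_def vec_eq_iff sum_UNIV_Plus split: sum.split)

lemma neg_mat_1_mult:
  fixes M :: "'a::ring_1^'m^'m"
  shows "(- mat 1) ** M = - M" "M ** (- mat 1) = - M"
proof -
  have "(- mat 1) ** M = - (mat 1 ** M)" "M ** (- mat 1) = - (M ** mat 1)"
    by (simp_all add: matrix_matrix_mult_def vec_eq_iff sum_negf)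
  then show "(- mat 1) ** M = - M" "M ** (- mat 1) = - M" by simp_all
qed

lemma zero_matrix_mult:
  fixes M :: "'a::ring_1^'m^'m"
  shows "(0 :: 'a^'m^'m) ** M = 0" "M ** (0 :: 'a^'m^'m) = 0"
  by (simp_all add: matrix_matrix_mult_def vec_eq_iff)

lemma OSp_block_form:
  "(OSp :: (real^('m::finite + 'm)^('m + 'm)) set) =
     {block_matrix Ur (- Ui) Ui Ur | Ur Ui. orthogonal_matrix (block_matrix Ur (- Ui) Ui Ur)}"
proof -
  have "R ** symplectic_J = symplectic_J ** R \<longleftrightarrow> (\<exists>Ur Ui. R = block_matrix Ur (- Ui) Ui Ur)"
    for R :: "real^('m + 'm)^('m + 'm)"
  proof -
    obtain a b c d where R: "R = block_matrix a b c d" using block_matrix_surj by blast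
    show ?thesis
      unfolding R symplectic_J_def
      by (auto simp: block_matrix_mult block_matrix_eq_iff neg_mat_1_mult zero_matrix_mult)
  qed
  then show ?thesis unfolding OSp_def by auto
qed

end

theory Submission
  imports Defs
begin

text \<open>
  Identify the real block matrix with blocks \<open>Ur\<close>, \<open>-Ui\<close>, \<open>Ui\<close>, \<open>Ur\<close> with the complex matrix
  \<open>C = Ur + i Ui\<close>. The identification respects products and adjoints, so ortho-symplectic
  matrices are exactly the unitary \<open>C\<close>. The matrices that commute with \<open>J\<close> and those that
  anticommute with \<open>J\<close> are orthogonal complements of each other in the Frobenius inner product. The
  commuting part of \<open>A\<close> corresponds to \<open>B\<close>, and the anticommuting part contributes a constant:
  \[ \|A - R\|^2 = 2 \|B - C\|^2 + \tfrac14 \|AJ - JA\|^2. \]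
  What remains is the problem of finding the unitary matrices nearest to \<open>B\<close>.

  Given a singular value decomposition \<open>B = U S V*\<close>, put \<open>W = U* C V\<close>, which is again unitary.
  Unitary invariance of the norm gives (lemma \<open>norm_diff_unitary_svd\<close>)
  \[ \|B - C\|^2 = \|S - I\|^2 + 2 \sum_i \sigma_i (1 - \mathrm{Re}\, W_{ii}), \]
  and all summands are nonnegative since \<open>W\<close> has rows of norm one. The minimum is therefore
  \<open>\<parallel>S - I\<parallel>\<^sup>2\<close>, reached precisely if row \<open>i\<close> of \<open>W\<close> is the \<open>i\<close>-th unit vector whenever
  \<open>\<sigma>\<^sub>i > 0\<close>. Then \<open>W* S = S\<close>, so \<open>B = (U W) S V*\<close> is another singular value decomposition,
  and \<open>C = (U W) V*\<close> is its polar factor.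

  The existence of a singular value decomposition is obtained variationally, without a spectral
  theorem. Fix distinct positive weights \<open>c\<^sub>i\<close>, let \<open>D\<close> be the diagonal matrix with these entries,
  and maximise \<open>Re tr (D U* B V)\<close> over the compact set of pairs of unitary matrices. At a maximum,
  with \<open>M = U* B V\<close>, neither \<open>M D\<close> nor \<open>D M\<close> can increase the real part of its trace by
  multiplication with a unitary matrix, and this forces both to be positive semidefinite
  (lemma \<open>trace_maximal_imp_hermitian_nonneg\<close>). Comparing entries, \<open>M\<^sub>i\<^sub>j c\<^sub>j\<^sup>2 = M\<^sub>i\<^sub>j c\<^sub>i\<^sup>2\<close>,
  so \<open>M\<close> is diagonal with nonnegative entries.
\<close>

section \<open>Adjoints, unitary matrices and the Frobenius inner product\<close>

lemma conj_transpose_mult: "conj_transpose (M ** N) = conj_transpose N ** conj_transpose M"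
  by (simp add: conj_transpose_def matrix_matrix_mult_def vec_eq_iff mult.commute)

lemma conj_transpose_conj_transpose [simp]: "conj_transpose (conj_transpose M) = M"
  by (simp add: conj_transpose_def vec_eq_iff)

lemma conj_transpose_mat_1 [simp]: "conj_transpose (mat 1) = mat 1"
  by (auto simp: conj_transpose_def mat_def vec_eq_iff)

lemma unitary_matrix_conj_transpose:
  "unitary_matrix U \<Longrightarrow> unitary_matrix (conj_transpose U)"
  by (simp add: unitary_matrix_def)

lemma unitary_matrix_iff_left: "unitary_matrix U \<longleftrightarrow> conj_transpose U ** U = mat 1"
  unfolding unitary_matrix_def using matrix_left_right_inverse by blast

lemma unitary_matrix_cancel:
  assumes "unitary_matrix U"
  shows "conj_transpose U ** (U ** M) = M" "U ** (conj_transpose U ** M) = M"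
    "M ** conj_transpose U ** U = M" "M ** U ** conj_transpose U = M"
  using assms
  by (simp_all add: unitary_matrix_def matrix_mul_assoc)
     (simp_all add: matrix_mul_assoc[symmetric])

lemma unitary_matrix_mult:
  assumes "unitary_matrix U" "unitary_matrix V"
  shows "unitary_matrix (U ** V)"
proof -
  have "conj_transpose (U ** V) ** (U ** V) = conj_transpose V ** (conj_transpose U ** (U ** V))"
    by (simp add: conj_transpose_mult matrix_mul_assoc)
  also have "\<dots> = mat 1"
    using assms by (simp add: unitary_matrix_cancel unitary_matrix_iff_left)
  finally show ?thesis by (simp add: unitary_matrix_iff_left)
qed

lemma inner_matrix_eq_trace:
  fixes M N :: "complex^'m^'m"
  shows "M \<bullet> N = Re (trace (conj_transpose M ** N))"
proof -
  have "M \<bullet> N = (\<Sum>i\<in>UNIV. \<Sum>j\<in>UNIV. Re (cnj (M $ i $ j) * N $ i $ j))"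
    by (simp add: inner_vec_def inner_complex_def)
  also have "\<dots> = (\<Sum>j\<in>UNIV. \<Sum>i\<in>UNIV. Re (cnj (M $ i $ j) * N $ i $ j))"
    by (rule sum.swap)
  also have "\<dots> = Re (trace (conj_transpose M ** N))"
    by (simp add: trace_def conj_transpose_def matrix_matrix_mult_def)
  finally show ?thesis .
qed

lemma norm_unitary_mult:
  assumes "unitary_matrix U"
  shows "norm (U ** M) = norm M" "norm (M ** U) = norm M"
proof -
  have "(U ** M) \<bullet> (U ** M) = M \<bullet> M"
    using assms by (simp add: inner_matrix_eq_trace conj_transpose_mult
        matrix_mul_assoc[symmetric] unitary_matrix_cancel)
  then show "norm (U ** M) = norm M" by (simp add: norm_eq_sqrt_inner)
  have "trace (conj_transpose U ** (conj_transpose M ** (M ** U)))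
      = trace (conj_transpose M ** (M ** U) ** conj_transpose U)"
    by (rule trace_mul_sym)
  then have "(M ** U) \<bullet> (M ** U) = M \<bullet> M"
    using assms by (simp add: inner_matrix_eq_trace conj_transpose_mult
        matrix_mul_assoc unitary_matrix_cancel)
  then show "norm (M ** U) = norm M" by (simp add: norm_eq_sqrt_inner)
qed

lemma unitary_matrix_row_norm:
  assumes "unitary_matrix W"
  shows "(\<Sum>j\<in>UNIV. (cmod (W $ i $ j))\<^sup>2) = 1"
proof -
  have "(W ** conj_transpose W) $ i $ i = 1"
    using assms by (simp add: unitary_matrix_def mat_def)
  then have "(\<Sum>j\<in>UNIV. complex_of_real ((cmod (W $ i $ j))\<^sup>2)) = 1"
    by (simp only: complex_norm_square matrix_matrix_mult_def conj_transpose_def vec_lambda_beta)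
  then show ?thesis
    by (metis of_real_sum of_real_eq_1_iff)
qed

lemma unitary_matrix_entry_le_1:
  assumes "unitary_matrix W"
  shows "cmod (W $ i $ j) \<le> 1"
proof -
  have "(cmod (W $ i $ j))\<^sup>2 \<le> (\<Sum>j\<in>UNIV. (cmod (W $ i $ j))\<^sup>2)"
    by (rule member_le_sum) auto
  then show ?thesis
    using unitary_matrix_row_norm[OF assms] by (simp add: power_le_one_iff abs_square_le_1)
qed

lemma unitary_matrix_Re_diag_le_1: "unitary_matrix W \<Longrightarrow> Re (W $ i $ i) \<le> 1"
  using unitary_matrix_entry_le_1[of W i i] complex_Re_le_cmod[of "W $ i $ i"] by linarith

text \<open>A row of a unitary matrix has norm one, so a diagonal entry of real part one leaves no room
  for anything else in the row.\<close>

lemma unitary_matrix_row_unit_vector: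
  assumes W: "unitary_matrix W" and re: "Re (W $ i $ i) = 1"
  shows "W $ i $ j = (if i = j then 1 else 0)"
proof -
  have le: "cmod (W $ i $ i) = 1"
    using unitary_matrix_entry_le_1[OF W, of i i] complex_Re_le_cmod[of "W $ i $ i"] re by linarith
  then have "(Re (W $ i $ i))\<^sup>2 + (Im (W $ i $ i))\<^sup>2 = 1"
    using cmod_power2[of "W $ i $ i"] by simp
  then have diag: "W $ i $ i = 1"
    using re by (simp add: complex_eq_iff)
  have "(cmod (W $ i $ i))\<^sup>2 + (\<Sum>j\<in>UNIV - {i}. (cmod (W $ i $ j))\<^sup>2) = 1"
    using unitary_matrix_row_norm[OF W, of i] by (subst (asm) sum.remove[of _ i]) auto
  then have "(\<Sum>j\<in>UNIV - {i}. (cmod (W $ i $ j))\<^sup>2) = 0"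
    using le by simp
  then have "\<forall>j\<in>UNIV - {i}. (cmod (W $ i $ j))\<^sup>2 = 0"
    by (subst (asm) sum_nonneg_eq_0_iff) auto
  then show ?thesis using diag by auto
qed

section \<open>Existence of a singular value decomposition\<close>

lemma real_nonneg_if_rotation_maximal:
  assumes "\<And>z. cmod z = 1 \<Longrightarrow> Re (z * q) \<le> Re q"
  shows "q \<in> \<real>\<^sub>\<ge>\<^sub>0"
proof (cases "q = 0")
  case False
  \<comment> \<open>Rotate \<open>q\<close> onto the positive real axis.\<close>
  have "Re (cnj q / cmod q * q) = cmod q"
    using False by (simp add: complex_norm_square[symmetric] mult.commute[of "cnj q"] power2_eq_square)
  moreover have "cmod (cnj q / cmod q) = 1"
    using False by (simp add: norm_divide)
  ultimately have le: "cmod q \<le> Re q"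
    using assms by metis
  then have eq: "cmod q = Re q"
    using complex_Re_le_cmod[of q] by linarith
  then have "Im q = 0"
    using cmod_power2[of q] by simp
  then show ?thesis
    using eq by (metis complex_nonneg_Reals_iff norm_ge_zero)
qed auto

text \<open>The linear map that multiplies \<open>v\<close> by \<open>z\<close> and fixes the orthogonal complement of \<open>v\<close>.\<close>

definition complex_reflection :: "complex^'m \<Rightarrow> complex \<Rightarrow> complex^'m^'m" where
  "complex_reflection v z =
     (\<chi> i j. (if i = j then 1 else 0) - (1 - z) / of_real ((norm v)\<^sup>2) * v $ i * cnj (v $ j))"

lemma sum_cnj_mult_self:
  fixes v :: "complex^'m"
  shows "(\<Sum>k\<in>UNIV. cnj (v $ k) * v $ k) = of_real ((norm v)\<^sup>2)"
proof -
  have "(norm v)\<^sup>2 = (\<Sum>k\<in>UNIV. (cmod (v $ k))\<^sup>2)"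
    by (simp add: norm_vec_def L2_set_def sum_nonneg)
  then show ?thesis
    by (simp add: complex_norm_square mult.commute del: of_real_power)
qed

lemma unitary_complex_reflection:
  fixes v :: "complex^'m"
  assumes v: "v \<noteq> 0" and z: "cmod z = 1"
  shows "unitary_matrix (complex_reflection v z)"
proof -
  define t where "t = complex_of_real ((norm v)\<^sup>2)"
  have t: "t \<noteq> 0" "cnj t = t" using v by (auto simp: t_def)
  define w where "w = (1 - z) / t"
  have zz: "cnj z * z = 1"
    using complex_norm_square[of z] z by (simp add: mult.commute)
  \<comment> \<open>This is where the modulus of \<open>z\<close> enters.\<close>
  have w: "cnj w * w * t = w + cnj w"
    using t zz by (simp add: w_def field_simps)
  have "(conj_transpose (complex_reflection v z) ** complex_reflection v z) $ i $ j = mat 1 $ i $ j"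
    for i j
  proof -
    have "(conj_transpose (complex_reflection v z) ** complex_reflection v z) $ i $ j =
       (\<Sum>k\<in>UNIV. ((if k = i then 1 else 0) - cnj w * cnj (v $ k) * v $ i)
                 * ((if k = j then 1 else 0) - w * v $ k * cnj (v $ j)))"
      using t by (auto simp: conj_transpose_def complex_reflection_def matrix_matrix_mult_def
          w_def t_def intro!: sum.cong)
    also have "\<dots> = (\<Sum>k\<in>UNIV. (if k = i then (if i = j then 1 else 0) else 0)
        - (if k = i then w * v $ i * cnj (v $ j) else 0)
        - (if k = j then cnj w * cnj (v $ j) * v $ i else 0)
        + cnj w * w * v $ i * cnj (v $ j) * (cnj (v $ k) * v $ k))"
      by (intro sum.cong) (auto simp: algebra_simps)
    also have "\<dots> = (if i = j then 1 else 0) - w * v $ i * cnj (v $ j)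
        - cnj w * cnj (v $ j) * v $ i + cnj w * w * v $ i * cnj (v $ j) * t"
      by (simp add: sum.distrib sum_subtractf sum_distrib_left[symmetric] sum_cnj_mult_self t_def
          del: of_real_power)
    also have "\<dots> = (if i = j then 1 else 0) + (cnj w * w * t - (w + cnj w)) * v $ i * cnj (v $ j)"
      by (simp add: algebra_simps)
    also have "\<dots> = mat 1 $ i $ j"
      using w by (simp add: mat_def)
    finally show ?thesis .
  qed
  then show ?thesis
    by (simp add: unitary_matrix_iff_left vec_eq_iff)
qed

text \<open>Let \<open>q\<close> be the value of the form at \<open>v\<close>. Multiplying \<open>K\<close> by the complex reflection along \<open>v\<close>
  lowers the trace by \<open>(1 - z) q / \<parallel>v\<parallel>\<^sup>2\<close>. By maximality no rotation of \<open>q\<close> in the complex plane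
  has a larger real part than \<open>q\<close> itself.\<close>

lemma trace_maximal_imp_quadratic_form_nonneg:
  fixes K :: "complex^'m^'m"
  assumes max: "\<And>X. unitary_matrix X \<Longrightarrow> Re (trace (X ** K)) \<le> Re (trace K)"
  shows "(\<Sum>i\<in>UNIV. \<Sum>j\<in>UNIV. cnj (v $ i) * K $ i $ j * v $ j) \<in> \<real>\<^sub>\<ge>\<^sub>0"
proof (cases "v = 0")
  case False
  define q where "q = (\<Sum>i\<in>UNIV. \<Sum>j\<in>UNIV. cnj (v $ i) * K $ i $ j * v $ j)"
  define n where "n = (norm v)\<^sup>2"
  have n: "n > 0" using False by (simp add: n_def)
  have tr: "trace (complex_reflection v z ** K) = trace K - (1 - z) / of_real n * q" for z
  proof -
    define w where "w = (1 - z) / of_real n"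
    have "trace (complex_reflection v z ** K) =
       (\<Sum>j\<in>UNIV. \<Sum>i\<in>UNIV. (if i = j then K $ i $ j else 0)
          - w * (cnj (v $ i) * K $ i $ j * v $ j))"
      unfolding trace_def
      by (auto simp: complex_reflection_def matrix_matrix_mult_def n_def w_def algebra_simps
          intro!: sum.cong)
    also have "\<dots> = trace K
        - w * (\<Sum>j\<in>UNIV. \<Sum>i\<in>UNIV. cnj (v $ i) * K $ i $ j * v $ j)"
      by (simp add: sum_subtractf sum_distrib_left[symmetric] trace_def)
    also have "(\<Sum>j\<in>UNIV. \<Sum>i\<in>UNIV. cnj (v $ i) * K $ i $ j * v $ j) = q"
      unfolding q_def by (rule sum.swap)
    finally show ?thesis unfolding w_def .
  qed
  have "Re (z * q) \<le> Re q" if z: "cmod z = 1" for z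
  proof -
    have "Re ((1 - z) / of_real n * q) \<ge> 0"
      using max[OF unitary_complex_reflection[OF False z]] by (simp add: tr)
    also have "(1 - z) / of_real n * q = (q - z * q) / of_real n"
      by (simp add: algebra_simps)
    finally show ?thesis using n
      by (simp add: Re_divide_of_real zero_le_divide_iff)
  qed
  then show ?thesis
    unfolding q_def[symmetric] by (rule real_nonneg_if_rotation_maximal)
qed simp

lemma sum_sum_two_points:
  fixes f :: "'m::finite \<Rightarrow> 'm \<Rightarrow> complex"
  assumes "i \<noteq> j" and "\<And>k l. k \<notin> {i, j} \<or> l \<notin> {i, j} \<Longrightarrow> f k l = 0"
  shows "(\<Sum>k\<in>UNIV. \<Sum>l\<in>UNIV. f k l) = f i i + f i j + f j i + f j j"
proof -
  have "(\<Sum>k\<in>UNIV. \<Sum>l\<in>UNIV. f k l) = (\<Sum>k\<in>{i, j}. \<Sum>l\<in>UNIV. f k l)"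
    using assms(2) by (intro sum.mono_neutral_right) auto
  also have "\<dots> = (\<Sum>k\<in>{i, j}. \<Sum>l\<in>{i, j}. f k l)"
    using assms(2) by (intro sum.cong refl sum.mono_neutral_right) auto
  finally show ?thesis using assms(1) by simp
qed

text \<open>A complex matrix with real quadratic form is Hermitian, by polarisation: evaluate the form at
  \<open>e\<^sub>i\<close>, at \<open>e\<^sub>i + e\<^sub>j\<close> and at \<open>e\<^sub>i + \<i> e\<^sub>j\<close>.\<close>

lemma trace_maximal_imp_hermitian_nonneg:
  fixes K :: "complex^'m^'m"
  assumes max: "\<And>X. unitary_matrix X \<Longrightarrow> Re (trace (X ** K)) \<le> Re (trace K)"
  shows "K $ i $ i \<in> \<real>\<^sub>\<ge>\<^sub>0" and "K $ j $ i = cnj (K $ i $ j)"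
proof -
  note form = trace_maximal_imp_quadratic_form_nonneg[OF max]
  have diag: "K $ i $ i \<in> \<real>\<^sub>\<ge>\<^sub>0" for i
  proof -
    have "(\<Sum>k\<in>UNIV. \<Sum>l\<in>UNIV. cnj (axis i 1 $ k) * K $ k $ l * axis i 1 $ l)
        = (\<Sum>k\<in>UNIV. if k = i then (\<Sum>l\<in>UNIV. if l = i then K $ i $ i else 0) else 0)"
      by (intro sum.cong refl) (auto simp: axis_def if_distrib[of "\<lambda>x. _ * x"] cong: if_cong)
    then show ?thesis using form[of "axis i 1"] by simp
  qed
  show "K $ i $ i \<in> \<real>\<^sub>\<ge>\<^sub>0" by (rule diag)
  show "K $ j $ i = cnj (K $ i $ j)"
  proof (cases "i = j")
    case True
    then show ?thesis
      using diag[of i] by (simp add: complex_eq_iff complex_nonneg_Reals_iff)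
  next
    case False
    have pol: "K $ i $ i + K $ i $ j * a + cnj a * K $ j $ i + cnj a * K $ j $ j * a \<in> \<real>\<^sub>\<ge>\<^sub>0" for a
    proof -
      define v where "v = (\<chi> k. if k = i then 1 else if k = j then a else 0)"
      have "(\<Sum>k\<in>UNIV. \<Sum>l\<in>UNIV. cnj (v $ k) * K $ k $ l * v $ l)
          = K $ i $ i + K $ i $ j * a + cnj a * K $ j $ i + cnj a * K $ j $ j * a"
        using False by (subst sum_sum_two_points[of i j]) (auto simp: v_def)
      then show ?thesis using form[of v] by simp
    qed
    show ?thesis
      using pol[of 1] pol[of \<i>] diag[of i] diag[of j]
      by (simp add: complex_eq_iff complex_nonneg_Reals_iff)
  qed
qed

lemma compact_unitary_matrices: "compact {U :: complex^'m^'m. unitary_matrix U}"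
proof -
  have "unitary_matrix U \<longleftrightarrow>
      (\<forall>i j. (\<Sum>k\<in>UNIV. cnj (U $ k $ i) * U $ k $ j) = (if i = j then 1 else 0))"
    for U :: "complex^'m^'m"
    by (simp add: unitary_matrix_iff_left vec_eq_iff matrix_matrix_mult_def conj_transpose_def mat_def)
  then have "closed {U :: complex^'m^'m. unitary_matrix U}"
    by (simp only:) (intro closed_Collect_all closed_Collect_eq continuous_intros)
  moreover have "norm U = norm (mat 1 :: complex^'m^'m)" if "unitary_matrix U" for U :: "complex^'m^'m"
    using norm_unitary_mult(1)[OF that, of "mat 1"] by simp
  then have "bounded {U :: complex^'m^'m. unitary_matrix U}"
    unfolding bounded_iff by (metis mem_Collect_eq order_refl)
  ultimately show ?thesis by (simp add: compact_eq_bounded_closed)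
qed

text \<open>The weights \<open>c\<close> have to be distinct: for equal weights the maximum of the trace only yields a
  positive semidefinite matrix \<open>M\<close>, not a diagonal one.\<close>

lemma svd_exists:
  fixes B :: "complex^'m^'m"
  obtains U S V where "is_svd B U S V"
proof -
  obtain h :: "'m \<Rightarrow> nat" where h: "inj h"
    using finite_imp_inj_to_nat_seg[of "UNIV :: 'm set"] by auto
  define c where "c i = 1 + real (h i)" for i
  have cpos: "c i > 0" for i by (simp add: c_def)
  have cinj: "c i = c j \<longleftrightarrow> i = j" for i j
    using h by (simp add: c_def inj_eq)
  define D :: "complex^'m^'m" where "D = (\<chi> i j. if i = j then of_real (c i) else 0)"
  have left: "(D ** N) $ i $ j = of_real (c i) * N $ i $ j" for N i j
    by (simp add: D_def matrix_matrix_mult_def if_distrib[of "\<lambda>x. x * _"] cong: if_cong)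
  have right: "(N ** D) $ i $ j = N $ i $ j * of_real (c j)" for N i j
    by (simp add: D_def matrix_matrix_mult_def if_distrib[of "\<lambda>x. _ * x"] cong: if_cong)
  let ?T = "{U :: complex^'m^'m. unitary_matrix U}"
  define f where "f p = Re (trace (D ** (conj_transpose (fst p) ** B ** snd p)))"
    for p :: "(complex^'m^'m) \<times> (complex^'m^'m)"
  have cont: "continuous_on (?T \<times> ?T) f"
  proof -
    have "f = (\<lambda>p. Re (\<Sum>i\<in>UNIV. of_real (c i) *
        (\<Sum>k\<in>UNIV. (\<Sum>l\<in>UNIV. cnj (fst p $ l $ i) * B $ l $ k) * snd p $ k $ i)))"
      unfolding f_def trace_def left by (simp add: matrix_matrix_mult_def conj_transpose_def fun_eq_iff)
    then show ?thesis
      by (simp only:) (intro continuous_intros)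
  qed
  have "mat 1 \<in> ?T" by (simp add: unitary_matrix_iff_left)
  then obtain p where p: "p \<in> ?T \<times> ?T" and pmax: "\<And>y. y \<in> ?T \<times> ?T \<Longrightarrow> f y \<le> f p"
    using continuous_attains_sup[OF compact_Times[OF compact_unitary_matrices compact_unitary_matrices]
        _ cont] by blast
  obtain U V where UV: "p = (U, V)" by (cases p)
  have U: "unitary_matrix U" and V: "unitary_matrix V" using p by (auto simp: UV)
  define M where "M = conj_transpose U ** B ** V"
  have maxMD: "Re (trace (X ** (M ** D))) \<le> Re (trace (M ** D))" if X: "unitary_matrix X" for X
  proof -
    have "f (U ** conj_transpose X, V) \<le> f (U, V)"
      using pmax[of "(U ** conj_transpose X, V)"] U V X
      by (simp add: UV unitary_matrix_mult unitary_matrix_conj_transpose)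
    then have "Re (trace (D ** (X ** M))) \<le> Re (trace (D ** M))"
      by (simp add: f_def M_def conj_transpose_mult matrix_mul_assoc)
    then show ?thesis
      unfolding trace_mul_sym[of D] by (simp add: matrix_mul_assoc)
  qed
  have maxDM: "Re (trace (X ** (D ** M))) \<le> Re (trace (D ** M))" if X: "unitary_matrix X" for X
  proof -
    have "f (U, V ** X) \<le> f (U, V)"
      using pmax[of "(U, V ** X)"] U V X
      by (simp add: UV unitary_matrix_mult)
    then show ?thesis
      unfolding trace_mul_sym[of X] by (simp add: f_def M_def matrix_mul_assoc)
  qed
  have offdiag: "M $ i $ j = 0" if "i \<noteq> j" for i j
  proof -
    have 1: "M $ j $ i * of_real (c i) = cnj (M $ i $ j) * of_real (c j)"
      using trace_maximal_imp_hermitian_nonneg(2)[OF maxMD, of j i] by (simp add: right)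
    have 2: "of_real (c j) * M $ j $ i = cnj (M $ i $ j) * of_real (c i)"
      using trace_maximal_imp_hermitian_nonneg(2)[OF maxDM, of j i] by (simp add: left mult.commute)
    have "cnj (M $ i $ j) * of_real (c i) * of_real (c i)
        = of_real (c j) * (M $ j $ i * of_real (c i))"
      using 2 by (simp add: mult.assoc[symmetric])
    also have "\<dots> = cnj (M $ i $ j) * of_real (c j) * of_real (c j)"
      unfolding 1 by simp
    finally have "cnj (M $ i $ j) * of_real ((c i)\<^sup>2 - (c j)\<^sup>2) = 0"
      by (simp add: algebra_simps power2_eq_square)
    moreover have "(c i)\<^sup>2 \<noteq> (c j)\<^sup>2"
      using that cinj cpos[of i] cpos[of j] by (simp add: power2_eq_iff_nonneg less_imp_le)
    ultimately show ?thesis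
      by (metis mult_eq_0_iff of_real_eq_0_iff right_minus_eq complex_cnj_zero_iff)
  qed
  have diag: "M $ i $ i \<in> \<real>\<^sub>\<ge>\<^sub>0" for i
    using trace_maximal_imp_hermitian_nonneg(1)[OF maxMD, of i] cpos[of i]
    by (auto simp: right complex_nonneg_Reals_iff zero_le_mult_iff)
  have "B = U ** M ** conj_transpose V"
    using U V by (simp add: M_def matrix_mul_assoc unitary_matrix_cancel)
      (simp add: unitary_matrix_def)
  then have "is_svd B U M V"
    using U V offdiag diag by (auto simp: is_svd_def)
  then show ?thesis by (rule that)
qed

section \<open>The nearest unitary matrices\<close>

lemma matrix_mult_diff:
  fixes L M N :: "'a::ring_1^'m::finite^'m"
  shows "L ** (M - N) = L ** M - L ** N" "(M - N) ** L = M ** L - N ** L"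
  by (simp_all add: matrix_matrix_mult_def vec_eq_iff algebra_simps sum_subtractf)

lemma is_svd_unitary_twist:
  assumes "is_svd B U S V" "unitary_matrix C"
  shows "unitary_matrix (conj_transpose U ** C ** V)"
  using assms by (simp add: is_svd_def unitary_matrix_mult unitary_matrix_conj_transpose)

text \<open>By unitary invariance the left-hand side is \<open>\<parallel>S - W\<parallel>\<^sup>2\<close>. As \<open>W\<close> and \<open>mat 1\<close> have the same norm,
  it differs from \<open>\<parallel>S - mat 1\<parallel>\<^sup>2\<close> only in the inner product with \<open>S\<close>, which sees nothing but the
  diagonal of \<open>W\<close> because \<open>S\<close> is diagonal.\<close>

lemma norm_diff_unitary_svd:
  fixes B :: "complex^'m^'m"
  assumes svd: "is_svd B U S V" and C: "unitary_matrix C"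
  defines "W \<equiv> conj_transpose U ** C ** V"
  shows "(norm (B - C))\<^sup>2 =
    (norm (S - mat 1))\<^sup>2 + 2 * (\<Sum>i\<in>UNIV. Re (S $ i $ i) * (1 - Re (W $ i $ i)))"
proof -
  have U: "unitary_matrix U" and V: "unitary_matrix V" and B: "B = U ** S ** conj_transpose V"
    and off: "\<And>i j. i \<noteq> j \<Longrightarrow> S $ i $ j = 0" and diag: "\<And>i. S $ i $ i \<in> \<real>\<^sub>\<ge>\<^sub>0"
    using svd by (auto simp: is_svd_def)
  have W: "unitary_matrix W"
    unfolding W_def using svd C by (rule is_svd_unitary_twist)
  have CW: "C = U ** W ** conj_transpose V"
    using U V by (simp add: W_def matrix_mul_assoc unitary_matrix_cancel)
      (simp add: unitary_matrix_def)
  have "B - C = U ** (S - W) ** conj_transpose V"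
    unfolding B CW by (simp add: matrix_mult_diff)
  then have "norm (B - C) = norm (S - W)"
    using U V by (simp add: norm_unitary_mult unitary_matrix_conj_transpose)
  moreover have "norm W = norm (mat 1 :: complex^'m^'m)"
    using norm_unitary_mult(1)[OF W, of "mat 1"] by simp
  then have "W \<bullet> W = (mat 1 :: complex^'m^'m) \<bullet> mat 1"
    by (simp add: norm_eq_sqrt_inner)
  moreover have cross: "S \<bullet> N = (\<Sum>i\<in>UNIV. Re (S $ i $ i) * Re (N $ i $ i))" for N
  proof -
    have "S \<bullet> N = (\<Sum>i\<in>UNIV. \<Sum>j\<in>UNIV. if j = i then Re (S $ i $ i) * Re (N $ i $ i) else 0)"
      unfolding inner_vec_def
      using off diag by (intro sum.cong) (auto simp: inner_complex_def complex_nonneg_Reals_iff)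
    then show ?thesis by simp
  qed
  ultimately have "(norm (B - C))\<^sup>2 = (norm (S - mat 1))\<^sup>2 + 2 * (S \<bullet> mat 1 - S \<bullet> W)"
    by (simp add: power2_norm_eq_inner inner_diff_left inner_diff_right inner_commute)
  then show ?thesis
    unfolding cross by (simp add: mat_def sum_subtractf right_diff_distrib)
qed

lemma nearest_unitary_bound:
  assumes svd: "is_svd B U S V" and C: "unitary_matrix C"
  shows "(norm (S - mat 1))\<^sup>2 \<le> (norm (B - C))\<^sup>2"
proof -
  have "0 \<le> Re (S $ i $ i) * (1 - Re ((conj_transpose U ** C ** V) $ i $ i))" for i
    using svd unitary_matrix_Re_diag_le_1[OF is_svd_unitary_twist[OF svd C], of i]
    by (auto simp: is_svd_def complex_nonneg_Reals_iff intro!: mult_nonneg_nonneg)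
  then show ?thesis
    unfolding norm_diff_unitary_svd[OF svd C] by (simp add: sum_nonneg)
qed

lemma norm_diff_svd_polar_factor:
  assumes svd: "is_svd B U S V"
  shows "unitary_matrix (U ** conj_transpose V)"
    and "(norm (B - U ** conj_transpose V))\<^sup>2 = (norm (S - mat 1))\<^sup>2"
proof -
  have U: "unitary_matrix U" and V: "unitary_matrix V" using svd by (auto simp: is_svd_def)
  show C: "unitary_matrix (U ** conj_transpose V)"
    using U V by (simp add: unitary_matrix_mult unitary_matrix_conj_transpose)
  have W: "conj_transpose U ** (U ** conj_transpose V) ** V = mat 1"
    using U V by (simp add: unitary_matrix_cancel) (simp add: unitary_matrix_def)
  show "(norm (B - U ** conj_transpose V))\<^sup>2 = (norm (S - mat 1))\<^sup>2"
    unfolding norm_diff_unitary_svd[OF svd C] W by (simp add: mat_def)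
qed

text \<open>A minimiser need not be the polar factor of the given decomposition if \<open>B\<close> is singular; it is
  the polar factor of the decomposition with \<open>U\<close> replaced by \<open>U ** W\<close>,
  where \<open>W\<close> is \<open>C\<close> in the coordinates given by \<open>U\<close> and \<open>V\<close>.\<close>

lemma nearest_unitary_imp_polar_factor:
  fixes B :: "complex^'m^'m"
  assumes svd: "is_svd B U S V" and C: "unitary_matrix C"
    and eq: "(norm (B - C))\<^sup>2 = (norm (S - mat 1))\<^sup>2"
  shows "is_polar_factor B C"
proof -
  have U: "unitary_matrix U" and V: "unitary_matrix V" and B: "B = U ** S ** conj_transpose V"
    and off: "\<And>i j. i \<noteq> j \<Longrightarrow> S $ i $ j = 0" and diag: "\<And>i. S $ i $ i \<in> \<real>\<^sub>\<ge>\<^sub>0"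
    using svd by (auto simp: is_svd_def)
  define W where "W = conj_transpose U ** C ** V"
  have W: "unitary_matrix W"
    unfolding W_def using svd C by (rule is_svd_unitary_twist)
  have CW: "C = U ** W ** conj_transpose V"
    using U V by (simp add: W_def matrix_mul_assoc unitary_matrix_cancel)
      (simp add: unitary_matrix_def)
  have nonneg: "0 \<le> Re (S $ i $ i) * (1 - Re (W $ i $ i))" for i
    using diag[of i] unitary_matrix_Re_diag_le_1[OF W, of i]
    by (auto simp: complex_nonneg_Reals_iff intro!: mult_nonneg_nonneg)
  have "(\<Sum>i\<in>UNIV. Re (S $ i $ i) * (1 - Re (W $ i $ i))) = 0"
    using norm_diff_unitary_svd[OF svd C] eq by (simp add: W_def)
  then have zero: "Re (S $ i $ i) * (1 - Re (W $ i $ i)) = 0" for i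
    using nonneg by (subst (asm) sum_nonneg_eq_0_iff) auto
  have row: "S $ i $ i = 0 \<or> (\<forall>j. W $ i $ j = (if i = j then 1 else 0))" for i
    using zero[of i] diag[of i] unitary_matrix_row_unit_vector[OF W, of i]
    by (auto simp: complex_nonneg_Reals_iff complex_eq_iff)
  have "(conj_transpose W ** S) $ j $ i = S $ j $ i" for j i
  proof -
    have "(conj_transpose W ** S) $ j $ i
        = (\<Sum>k\<in>UNIV. if k = i then cnj (W $ i $ j) * S $ i $ i else 0)"
      unfolding matrix_matrix_mult_def conj_transpose_def vec_lambda_beta
      by (intro sum.cong) (auto simp: off)
    also have "\<dots> = S $ j $ i"
      using row[of i] off[of j i] by (cases "j = i") auto
    finally show ?thesis .
  qed
  then have WS: "conj_transpose W ** S = S" by (simp add: vec_eq_iff)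
  have "U ** W ** S = U ** S"
    using unitary_matrix_cancel(2)[OF W, of S] by (simp add: WS matrix_mul_assoc[symmetric])
  then have "is_svd B (U ** W) S V"
    using U V W off diag by (simp add: is_svd_def B unitary_matrix_mult)
  then show ?thesis
    unfolding is_polar_factor_def CW by blast
qed

theorem polar_factor_iff_nearest_unitary:
  "is_polar_factor B C \<longleftrightarrow>
     unitary_matrix C \<and> (\<forall>C'. unitary_matrix C' \<longrightarrow> norm (B - C) \<le> norm (B - C'))"
proof
  assume "is_polar_factor B C"
  then obtain U S V where svd: "is_svd B U S V" and C: "C = U ** conj_transpose V"
    by (auto simp: is_polar_factor_def)
  have "norm (B - C) \<le> norm (B - C')" if "unitary_matrix C'" for C'
    using nearest_unitary_bound[OF svd that] norm_diff_svd_polar_factor(2)[OF svd]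
    by (simp add: C power2_le_iff_abs_le)
  then show "unitary_matrix C \<and> (\<forall>C'. unitary_matrix C' \<longrightarrow> norm (B - C) \<le> norm (B - C'))"
    using norm_diff_svd_polar_factor(1)[OF svd] C by blast
next
  assume near: "unitary_matrix C \<and> (\<forall>C'. unitary_matrix C' \<longrightarrow> norm (B - C) \<le> norm (B - C'))"
  obtain U S V where svd: "is_svd B U S V" by (rule svd_exists)
  have "norm (B - C) \<le> norm (B - U ** conj_transpose V)"
    using near norm_diff_svd_polar_factor(1)[OF svd] by blast
  then have "(norm (B - C))\<^sup>2 \<le> (norm (S - mat 1))\<^sup>2"
    using norm_diff_svd_polar_factor(2)[OF svd] by (metis norm_ge_zero power_mono)
  then show "is_polar_factor B C"
    using near nearest_unitary_bound[OF svd] nearest_unitary_imp_polar_factor[OF svd]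
    by (meson order_antisym)
qed

section \<open>Ortho-symplectic matrices as unitary matrices\<close>

lemma complex_matrix_mult:
  "complex_matrix X Y ** complex_matrix X' Y' = complex_matrix (X ** X' - Y ** Y') (X ** Y' + Y ** X')"
  by (simp add: complex_matrix_def matrix_matrix_mult_def vec_eq_iff complex_eq_iff
      sum_subtractf sum.distrib)

lemma conj_transpose_complex_matrix:
  "conj_transpose (complex_matrix X Y) = complex_matrix (transpose X) (- transpose Y)"
  by (simp add: complex_matrix_def conj_transpose_def transpose_def vec_eq_iff complex_eq_iff)

lemma complex_matrix_eq_iff: "complex_matrix X Y = complex_matrix X' Y' \<longleftrightarrow> X = X' \<and> Y = Y'"
  by (auto simp: complex_matrix_def vec_eq_iff complex_eq_iff)

lemma complex_matrix_surj: obtains X Y where "M = complex_matrix X Y"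
proof
  show "M = complex_matrix (\<chi> i j. Re (M $ i $ j)) (\<chi> i j. Im (M $ i $ j))"
    by (simp add: complex_matrix_def vec_eq_iff complex_eq_iff)
qed

lemma complex_matrix_1: "mat 1 = complex_matrix (mat 1) 0"
  by (simp add: complex_matrix_def mat_def vec_eq_iff complex_eq_iff)

lemma complex_matrix_diff:
  "complex_matrix X Y - complex_matrix X' Y' = complex_matrix (X - X') (Y - Y')"
  by (simp add: complex_matrix_def vec_eq_iff complex_eq_iff)

lemma norm_complex_matrix: "(norm (complex_matrix X Y))\<^sup>2 = (norm X)\<^sup>2 + (norm Y)\<^sup>2"
  by (simp add: power2_norm_eq_inner inner_vec_def inner_complex_def complex_matrix_def sum.distrib)

lemma transpose_block_matrix:
  "transpose (block_matrix a b c d)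
    = block_matrix (transpose a) (transpose c) (transpose b) (transpose d)"
  by (auto simp: block_matrix_def transpose_def vec_eq_iff split: sum.split)

lemma block_matrix_1: "mat 1 = block_matrix (mat 1) 0 0 (mat 1)"
  by (auto simp: block_matrix_def mat_def vec_eq_iff split: sum.split)

lemma block_matrix_diff:
  fixes a b c d :: "'a::ab_group_add^'m::finite^'m"
  shows "block_matrix a b c d - block_matrix a' b' c' d'
    = block_matrix (a - a') (b - b') (c - c') (d - d')"
  by (auto simp: block_matrix_def vec_eq_iff split: sum.split)

lemma norm_block_matrix:
  fixes a b c d :: "real^'m::finite^'m"
  shows "(norm (block_matrix a b c d))\<^sup>2 = (norm a)\<^sup>2 + (norm b)\<^sup>2 + (norm c)\<^sup>2 + (norm d)\<^sup>2"
  by (simp add: power2_norm_eq_inner inner_vec_def block_matrix_def sum_UNIV_Plus sum.distrib)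

lemma matrix_mult_uminus:
  fixes M N :: "'a::ring_1^'m::finite^'m"
  shows "(- M) ** N = - (M ** N)" "M ** (- N) = - (M ** N)"
  by (simp_all add: matrix_matrix_mult_def vec_eq_iff sum_negf)

lemma orthogonal_block_matrix_iff_unitary:
  "orthogonal_matrix (block_matrix Ur (- Ui) Ui Ur) \<longleftrightarrow> unitary_matrix (complex_matrix Ur Ui)"
proof -
  have "transpose (- Ui) = - transpose Ui"
    by (simp add: transpose_def vec_eq_iff)
  then show ?thesis
    by (auto simp: orthogonal_matrix unitary_matrix_iff_left transpose_block_matrix
        block_matrix_mult block_matrix_1 block_matrix_eq_iff conj_transpose_complex_matrix
        complex_matrix_mult complex_matrix_1 complex_matrix_eq_iff matrix_mult_uminus add.commute)
qed

lemma block_matrix_in_OSp_iff: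
  "block_matrix Ur (- Ui) Ui Ur \<in> OSp \<longleftrightarrow> unitary_matrix (complex_matrix Ur Ui)"
  by (auto simp: OSp_block_form block_matrix_eq_iff orthogonal_block_matrix_iff_unitary)

lemma OSp_cases:
  assumes "R \<in> OSp"
  obtains Ur Ui where "R = block_matrix Ur (- Ui) Ui Ur" "unitary_matrix (complex_matrix Ur Ui)"
  using assms by (auto simp: OSp_block_form orthogonal_block_matrix_iff_unitary)

text \<open>Per pair of blocks this is the parallelogram law, applied to \<open>A11 - Ur\<close> and \<open>A22 - Ur\<close>, and
  to \<open>A21 - Ui\<close> and \<open>A12 + Ui\<close>: of the half-sum and half-difference of each pair, one is the real or
  imaginary part of \<open>B - complex_matrix Ur Ui\<close> and the other is, up to a factor two and sign, a block
  of the commutator.\<close>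

lemma norm_diff_block_matrix:
  fixes A11 A12 A21 A22 Ur Ui :: "real^'m::finite^'m"
  defines "A \<equiv> block_matrix A11 A12 A21 A22"
    and "B \<equiv> complex_matrix ((A11 + A22) /\<^sub>R 2) ((A21 - A12) /\<^sub>R 2)"
  shows "(norm (A - block_matrix Ur (- Ui) Ui Ur))\<^sup>2 = 2 * (norm (B - complex_matrix Ur Ui))\<^sup>2
     + 1 / 4 * (norm (A ** symplectic_J - symplectic_J ** A))\<^sup>2"
proof -
  have comm: "A ** symplectic_J - symplectic_J ** A
      = block_matrix (A12 + A21) (A22 - A11) (A22 - A11) (- (A21 + A12))"
    by (simp add: A_def symplectic_J_def block_matrix_mult block_matrix_diff neg_mat_1_mult
        zero_matrix_mult)
  show ?thesis
    unfolding comm unfolding A_def B_def block_matrix_diff complex_matrix_diff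
      norm_block_matrix norm_complex_matrix
    by (simp add: power2_norm_eq_inner inner_diff_left inner_diff_right inner_add_left
        inner_add_right inner_commute field_simps)
qed

section \<open>The nearest ortho-symplectic matrices\<close>

theorem theorem8p2:
  fixes A :: "real^('m::finite + 'm)^('m + 'm)"
    and A11 A12 A21 A22 :: "real^'m^'m"
    and B :: "complex^'m^'m"
  assumes A: "A = block_matrix A11 A12 A21 A22"
    and B: "B = complex_matrix ((A11 + A22) /\<^sub>R 2) ((A21 - A12) /\<^sub>R 2)"
  shows "(\<forall>Ur Ui. is_nearest_OSp A (block_matrix Ur (- Ui) Ui Ur)
                    \<longleftrightarrow> is_polar_factor B (complex_matrix Ur Ui))
    \<and> (\<exists>R. is_nearest_OSp A R)
    \<and> (\<forall>R U S V. is_nearest_OSp A R \<longrightarrow> is_svd B U S V \<longrightarrow>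
          (norm (A - R))\<^sup>2 = 2 * (norm (S - mat 1))\<^sup>2
             + 1 / 4 * (norm (A ** symplectic_J - symplectic_J ** A))\<^sup>2)"
proof (intro conjI allI impI)
  note dist = norm_diff_block_matrix[of A11 A12 A21 A22, folded A B]
  have le_iff: "norm (A - block_matrix Ur (- Ui) Ui Ur) \<le> norm (A - block_matrix Xr (- Xi) Xi Xr)
      \<longleftrightarrow> norm (B - complex_matrix Ur Ui) \<le> norm (B - complex_matrix Xr Xi)" for Ur Ui Xr Xi
  proof -
    have "norm (A - block_matrix Ur (- Ui) Ui Ur) \<le> norm (A - block_matrix Xr (- Xi) Xi Xr)
        \<longleftrightarrow> (norm (A - block_matrix Ur (- Ui) Ui Ur))\<^sup>2
           \<le> (norm (A - block_matrix Xr (- Xi) Xi Xr))\<^sup>2"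
      by (rule power_mono_iff[symmetric]) auto
    also have "\<dots> \<longleftrightarrow> (norm (B - complex_matrix Ur Ui))\<^sup>2 \<le> (norm (B - complex_matrix Xr Xi))\<^sup>2"
      by (simp add: dist)
    also have "\<dots> \<longleftrightarrow> norm (B - complex_matrix Ur Ui) \<le> norm (B - complex_matrix Xr Xi)"
      by (rule power_mono_iff) auto
    finally show ?thesis .
  qed
  show iff: "is_nearest_OSp A (block_matrix Ur (- Ui) Ui Ur)
      \<longleftrightarrow> is_polar_factor B (complex_matrix Ur Ui)" for Ur Ui
  proof -
    have "is_nearest_OSp A (block_matrix Ur (- Ui) Ui Ur) \<longleftrightarrow>
        block_matrix Ur (- Ui) Ui Ur \<in> OSp
        \<and> (\<forall>R\<in>OSp. norm (A - block_matrix Ur (- Ui) Ui Ur) \<le> norm (A - R))"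
      by (auto simp: is_nearest_OSp_def is_arg_min_linorder)
    also have "\<dots> \<longleftrightarrow> unitary_matrix (complex_matrix Ur Ui)
        \<and> (\<forall>Xr Xi. unitary_matrix (complex_matrix Xr Xi) \<longrightarrow>
              norm (B - complex_matrix Ur Ui) \<le> norm (B - complex_matrix Xr Xi))"
      by (metis OSp_cases block_matrix_in_OSp_iff le_iff)
    also have "\<dots> \<longleftrightarrow> is_polar_factor B (complex_matrix Ur Ui)"
      unfolding polar_factor_iff_nearest_unitary by (metis complex_matrix_surj)
    finally show ?thesis .
  qed
  obtain U0 S0 V0 where "is_svd B U0 S0 V0" by (rule svd_exists)
  then have "is_polar_factor B (U0 ** conj_transpose V0)"
    by (auto simp: is_polar_factor_def)
  then show "\<exists>R. is_nearest_OSp A R"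
    using iff complex_matrix_surj by metis
  fix R U S V
  assume R: "is_nearest_OSp A R" and svd: "is_svd B U S V"
  then have "R \<in> OSp" by (simp add: is_nearest_OSp_def is_arg_min_def)
  then obtain Ur Ui where Req: "R = block_matrix Ur (- Ui) Ui Ur"
    and unit: "unitary_matrix (complex_matrix Ur Ui)"
    by (rule OSp_cases)
  have "is_polar_factor B (complex_matrix Ur Ui)"
    using R iff by (simp add: Req)
  then have "norm (B - complex_matrix Ur Ui) \<le> norm (B - U ** conj_transpose V)"
    using norm_diff_svd_polar_factor(1)[OF svd] by (simp add: polar_factor_iff_nearest_unitary)
  then have "(norm (B - complex_matrix Ur Ui))\<^sup>2 \<le> (norm (S - mat 1))\<^sup>2"
    using norm_diff_svd_polar_factor(2)[OF svd] by (metis norm_ge_zero power_mono)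
  then have "(norm (B - complex_matrix Ur Ui))\<^sup>2 = (norm (S - mat 1))\<^sup>2"
    using nearest_unitary_bound[OF svd unit] by simp
  then show "(norm (A - R))\<^sup>2 = 2 * (norm (S - mat 1))\<^sup>2
      + 1 / 4 * (norm (A ** symplectic_J - symplectic_J ** A))\<^sup>2"
    by (simp add: Req dist)
qed

end
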